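(* Throughout, a system of weights is a family $(\Omega_k(n))_{k,n\in\mathbb{N}}$ with $0<\Omega_{k-1}(n)\le\Omega_k(n)$ for all $k\ge1$, $n\in\mathbb{N}$. (A) Let $\kappa\in(0,1)$ be fixed and let $(\Omega_k(n))$ be a $\Delta_\kappa$-admissible system of weights. Then the following two conditions are equivalent: (i) $$\lim_{(k,n)_{\Delta_\kappa}\to\infty}\frac{\Omega_k(n)}{\Omega_{k-1}(n)}=1;$$ (ii) $$\sup_{n\in\mathbb{P}}\sum_{k=0}^{|n|}\Omega_k(n)=\infty .$$ (B) Let $\omega$ be a sequence as in the context. If a system of weights $(\Omega_k(n))$ is $\Delta_\omega$-admissible and $$\lim_{(k,n)_{\Delta_\omega}\to\infty}\frac{\Omega_k(n)}{\Omega_{k-1}(n)}=1,$$ then $\sup_{n\in\mathbb{P}}\sum_{k=0}^{|n|}\Omega_k(n)=\infty$. (C) The sufficient condition in (B) is not necessary in general: there exist a sequence $\omega$ as in the context and a $\Delta_\omega$-admissible system of weights $(\Omega_k(n))$ such that $\sup_{n\in\mathbb{P}}\sum_{k=0}^{|n|}\Omega_k(n)=\infty$ but $\lim_{(k,n)_{\Delta_\omega}\to\infty}\Omega_k(n)/\Omega_{k-1}(n)\ne1$.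
   Context: Notation: $\mathbb{P}=\{1,2,\dots\}$, $\mathbb{N}=\mathbb{P}\cup\{0\}$. For $n\in\mathbb{P}$, $|n|:=\lfloor\log_2 n\rfloor$ is the position of the highest nonzero binary digit of $n$. Cones: for $\kappa\in(0,1)$, $\Delta_\kappa:=\{(k,n)\in\mathbb{N}\times\mathbb{P}:\kappa|n|<k\le|n|\}$. For a nondecreasing sequence $\omega=(\omega_n)$ of positive integers with $\omega_n\to\infty$ and $|n|/\omega_n\to\infty$ as $n\to\infty$, $\Delta_\omega:=\{(k,n)\in\mathbb{N}\times\mathbb{P}:|n|-\omega_n<k\le|n|\}$. With $\Delta$ denoting $\Delta_\kappa$ or $\Delta_\omega$: for a family $(a_k(n))_{(k,n)\in\Delta}$ and a number $L$, $\lim_{(k,n)_\Delta\to\infty}a_k(n)=L$ means: for every $\varepsilon>0$ there is $N_0$ such that $|a_k(n)-L|<\varepsilon$ whenever $(k,n)\in\Delta$ and $|n|\ge N_0$. The system $(\Omega_k(n))$ is $\Delta$-admissible if (a) there is a finite limit $\lim_{(k,n)_\Delta\to\infty}\Omega_k(n)/\Omega_{k-1}(n)$, and (b) there are constants $0<c\le C<\infty$ with $c\le\Omega_{|n|}(n)\le C$ for all $n\in\mathbb{P}$. *)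

theory Defs
  imports Complex_Main "HOL-Library.Extended_Real"
begin

definition top_bit :: "nat \<Rightarrow> nat" where
  "top_bit n = nat \<lfloor>log 2 (real n)\<rfloor>"

definition cone_kappa :: "real \<Rightarrow> (nat \<times> nat) set" where
  "cone_kappa \<kappa> = {(k, n). 1 \<le> n \<and> \<kappa> * real (top_bit n) < real k \<and> k \<le> top_bit n}"

text \<open>Sequences are indexed by the positive integers; the value at index 0 is irrelevant.\<close>

definition width_seq :: "(nat \<Rightarrow> nat) \<Rightarrow> bool" where
  "width_seq \<omega> \<longleftrightarrow>
     (\<forall>n\<ge>1. 0 < \<omega> n) \<and> mono_on {1..} \<omega> \<and>
     filterlim \<omega> at_top sequentially \<and>
     filterlim (\<lambda>n. real (top_bit n) / real (\<omega> n)) at_top sequentially"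

text \<open>The subtraction is over the integers. A pair with \<open>k = 0\<close> lies in this cone only if
  \<open>top_bit n < \<omega> n\<close>, which for a width sequence happens for finitely many \<open>n\<close>, so such pairs
  do not affect limits along the cone.\<close>

definition cone_omega :: "(nat \<Rightarrow> nat) \<Rightarrow> (nat \<times> nat) set" where
  "cone_omega \<omega> = {(k, n). 1 \<le> n \<and> int (top_bit n) - int (\<omega> n) < int k \<and> k \<le> top_bit n}"

definition cone_lim :: "(nat \<times> nat) set \<Rightarrow> (nat \<Rightarrow> nat \<Rightarrow> real) \<Rightarrow> real \<Rightarrow> bool" where
  "cone_lim \<Delta> a L \<longleftrightarrow>
     (\<forall>\<epsilon>>0. \<exists>N0. \<forall>(k, n)\<in>\<Delta>. N0 \<le> top_bit n \<longrightarrow> \<bar>a k n - L\<bar> < \<epsilon>)"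

definition weight_system :: "(nat \<Rightarrow> nat \<Rightarrow> real) \<Rightarrow> bool" where
  "weight_system W \<longleftrightarrow> (\<forall>k\<ge>1. \<forall>n. 0 < W (k - 1) n \<and> W (k - 1) n \<le> W k n)"

definition admissible :: "(nat \<times> nat) set \<Rightarrow> (nat \<Rightarrow> nat \<Rightarrow> real) \<Rightarrow> bool" where
  "admissible \<Delta> W \<longleftrightarrow>
     (\<exists>L. cone_lim \<Delta> (\<lambda>k n. W k n / W (k - 1) n) L) \<and>
     (\<exists>c C. 0 < c \<and> c \<le> C \<and> (\<forall>n\<ge>1. c \<le> W (top_bit n) n \<and> W (top_bit n) n \<le> C))"

end

theory Submission
  imports Defs "HOL-Real_Asymp.Real_Asymp"
begin

text \<open>
  Read the weights of a column \<open>n\<close> downwards from the top index \<open>top_bit n\<close>, where admissibility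
  keeps them between two positive constants. The ratios in the cone say how fast they decay.

  If the ratios tend to 1, then for each fixed \<open>j\<close> the weight \<open>j\<close> steps below the top is
  asymptotically equal to the top weight. Every cone considered here eventually contains the top
  \<open>m\<close> positions, for every \<open>m\<close>, so the column sums eventually exceed a fixed multiple of \<open>m\<close>.
  This is \<open>weight_sums_unbounded_if_ratios_tend_to_one\<close>; it serves both kinds of cone.

  If the ratios tend to another limit, monotonicity of the weights forces that limit to exceed 1,
  so the weights decay at least geometrically as long as the index stays in the cone. The cone
  with slope \<open>\<kappa>\<close> is so wide that on leaving it the weights have become exponentially small in
  \<open>top_bit n\<close>; below it there are at most \<open>top_bit n + 1\<close> weights, none of them larger, and their
  sum stays bounded as well (\<open>weight_sums_bounded_if_ratios_exceed_one\<close>).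

  A cone of width \<open>\<omega>\<close> may be too narrow for this. In the example the weights halve \<open>\<omega> n\<close> times
  and then stay constant, so that a column sums to at least \<open>top_bit n / 2 ^ \<omega> n\<close>, and \<open>\<omega>\<close>
  is chosen to grow so slowly that this quotient tends to infinity.
\<close>

section \<open>The position of the highest binary digit\<close>

lemma top_bit_pow2 [simp]: "top_bit (2 ^ N) = N"
  by (simp add: top_bit_def log_nat_power)

lemma top_bit_0 [simp]: "top_bit 0 = 0"
  by (simp add: top_bit_def log_def)

lemma top_bit_mono: "m \<le> n \<Longrightarrow> top_bit m \<le> top_bit n"
proof (cases "m = 0")
  case True
  then show ?thesis by simp
next
  case False
  assume "m \<le> n"
  with False show ?thesis
    unfolding top_bit_def by (intro nat_mono floor_mono) simp
qed

lemma pow2_top_bit_le: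
  assumes "1 \<le> n"
  shows "2 ^ top_bit n \<le> n"
proof -
  have "real (top_bit n) \<le> log 2 (real n)"
    using assms by (simp add: top_bit_def)
  hence "2 powr real (top_bit n) \<le> real n"
    using assms by (simp add: le_log_iff)
  hence "real (2 ^ top_bit n) \<le> real n"
    by (simp add: powr_realpow)
  thus ?thesis by linarith
qed

lemma top_bit_less: "1 \<le> n \<Longrightarrow> top_bit n < n"
  using pow2_top_bit_le less_exp[of "top_bit n"] by (meson less_le_trans)

lemma filterlim_top_bit: "filterlim top_bit at_top sequentially"
  unfolding filterlim_at_top
proof
  fix Z
  show "\<forall>\<^sub>F n in sequentially. Z \<le> top_bit n"
    using eventually_ge_at_top[of "2 ^ Z :: nat"]
    by eventually_elim (use top_bit_mono[of "2 ^ Z"] in simp)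
qed

section \<open>Weights, ratios and unbounded suprema\<close>

lemma weight_pos: "weight_system W \<Longrightarrow> 0 < W k n"
  unfolding weight_system_def by (metis add_diff_cancel_right' le_add2)

lemma weight_mono:
  assumes "weight_system W" "k \<le> l"
  shows "W k n \<le> W l n"
  using assms(2)
proof (rule lift_Suc_mono_le[of "\<lambda>k. W k n", rotated])
  show "W k n \<le> W (Suc k) n" for k
    using assms(1) unfolding weight_system_def by (auto dest: spec[of _ "Suc k"])
qed

lemma ratio_ge_1: "weight_system W \<Longrightarrow> 1 \<le> W k n / W (k - 1) n"
  using weight_mono[of W "k - 1" k n] weight_pos[of W "k - 1" n] by simp

lemma SUP_ereal_eq_infinity_iff:
  fixes f :: "'a \<Rightarrow> real"
  shows "(SUP x\<in>A. ereal (f x)) = \<infinity> \<longleftrightarrow> (\<forall>M. \<exists>x\<in>A. M \<le> f x)"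
proof
  assume inf: "(SUP x\<in>A. ereal (f x)) = \<infinity>"
  show "\<forall>M. \<exists>x\<in>A. M \<le> f x"
  proof (rule ccontr)
    assume "\<not> ?thesis"
    then obtain M where "\<And>x. x \<in> A \<Longrightarrow> \<not> M \<le> f x" by blast
    hence "(SUP x\<in>A. ereal (f x)) \<le> ereal M" by (intro SUP_least) (simp add: less_imp_le not_le)
    with inf show False by simp
  qed
next
  assume "\<forall>M. \<exists>x\<in>A. M \<le> f x"
  thus "(SUP x\<in>A. ereal (f x)) = \<infinity>" by (intro SUP_PInfty) simp
qed

section \<open>Ratios tending to 1\<close>

text \<open>A fixed number of ratios close to 1 multiply to something close to 1. The columns \<open>2 ^ N\<close>
  suffice, as one column for each value of \<open>top_bit\<close>.\<close>

lemma weight_near_top_tendsto: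
  assumes W: "weight_system W"
    and lim: "cone_lim \<Delta> (\<lambda>k n. W k n / W (k - 1) n) 1"
    and deep: "\<And>j. \<forall>\<^sub>F N in sequentially. (N - j, 2 ^ N) \<in> \<Delta>"
  shows "(\<lambda>N. W (N - j) (2 ^ N) / W N (2 ^ N)) \<longlonglongrightarrow> 1"
proof (induction j)
  case 0
  have "W N n / W N n = 1" for N n using weight_pos[OF W, of N n] by simp
  thus ?case by simp
next
  case (Suc j)
  have "(\<lambda>N. W (N - j) (2 ^ N) / W (N - j - 1) (2 ^ N)) \<longlonglongrightarrow> 1"
  proof (rule tendstoI)
    fix e :: real assume "0 < e"
    then obtain N0 where N0: "\<And>k n. (k, n) \<in> \<Delta> \<Longrightarrow> N0 \<le> top_bit n \<Longrightarrow> \<bar>W k n / W (k - 1) n - 1\<bar> < e"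
      using lim unfolding cone_lim_def by fast
    show "\<forall>\<^sub>F N in sequentially. dist (W (N - j) (2 ^ N) / W (N - j - 1) (2 ^ N)) 1 < e"
      using deep[of j] eventually_ge_at_top[of N0]
    proof eventually_elim
      case (elim N)
      thus ?case using N0[of "N - j" "2 ^ N"] by (simp add: dist_real_def)
    qed
  qed
  from tendsto_divide[OF Suc this]
  have "(\<lambda>N. W (N - j) (2 ^ N) / W N (2 ^ N) / (W (N - j) (2 ^ N) / W (N - j - 1) (2 ^ N))) \<longlonglongrightarrow> 1"
    by simp
  moreover have "W (N - j) n / W N n / (W (N - j) n / W (N - j - 1) n) = W (N - Suc j) n / W N n" for N n
    using weight_pos[OF W, of "N - j" n] by simp
  ultimately show ?case by simp
qed

lemma weight_sums_unbounded_if_ratios_tend_to_one: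
  assumes W: "weight_system W"
    and c: "0 < c" "\<And>n. 1 \<le> n \<Longrightarrow> c \<le> W (top_bit n) n"
    and lim: "cone_lim \<Delta> (\<lambda>k n. W k n / W (k - 1) n) 1"
    and deep: "\<And>j. \<forall>\<^sub>F N in sequentially. (N - j, 2 ^ N) \<in> \<Delta>"
  shows "(SUP n\<in>{1..}. ereal (\<Sum>k=0..top_bit n. W k n)) = \<infinity>"
  unfolding SUP_ereal_eq_infinity_iff
proof
  fix M
  obtain m :: nat where m: "2 * M / c \<le> real m" using real_arch_simple by blast
  have "\<forall>\<^sub>F N in sequentially. \<forall>j\<in>{..<m}. 1 / 2 < W (N - j) (2 ^ N) / W N (2 ^ N)"
    by (intro eventually_ball_finite ballI order_tendstoD(1)[OF weight_near_top_tendsto[OF W lim deep]])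
       auto
  then obtain N where N: "m \<le> N" "\<And>j. j < m \<Longrightarrow> 1 / 2 < W (N - j) (2 ^ N) / W N (2 ^ N)"
    using eventually_happens[OF eventually_conj[OF _ eventually_ge_at_top[of m]]] by force
  have "M \<le> real m * (c / 2)" using m c(1) by (simp add: field_simps)
  also have "\<dots> = (\<Sum>j<m. c / 2)" by simp
  also have "\<dots> \<le> (\<Sum>j<m. W (N - j) (2 ^ N))"
  proof (intro sum_mono)
    fix j assume "j \<in> {..<m}"
    hence "W N (2 ^ N) / 2 < W (N - j) (2 ^ N)"
      using N(2)[of j] weight_pos[OF W, of N "2 ^ N"] by (simp add: field_simps)
    thus "c / 2 \<le> W (N - j) (2 ^ N)" using c(2)[of "2 ^ N"] by simp
  qed
  also have "\<dots> = (\<Sum>k\<in>(\<lambda>j. N - j) ` {..<m}. W k (2 ^ N))"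
    using N(1) by (subst sum.reindex) (auto simp: inj_on_def)
  also have "\<dots> \<le> (\<Sum>k=0..N. W k (2 ^ N))"
    by (intro sum_mono2) (auto intro: less_imp_le weight_pos[OF W])
  finally have "M \<le> (\<Sum>k=0..top_bit (2 ^ N). W k (2 ^ N))" by simp
  moreover have "(2 :: nat) ^ N \<in> {1..}" by simp
  ultimately show "\<exists>n\<in>{1..}. M \<le> (\<Sum>k=0..top_bit n. W k n)" by blast
qed

lemma cone_kappa_contains_top:
  assumes "\<kappa> < 1"
  shows "\<forall>\<^sub>F N in sequentially. (N - j, 2 ^ N) \<in> cone_kappa \<kappa>"
proof -
  obtain m :: nat where "real j / (1 - \<kappa>) < real m" using reals_Archimedean2 by blast
  hence m: "real j < (1 - \<kappa>) * real m" using assms by (simp add: field_simps)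
  show ?thesis
    using eventually_ge_at_top[of m] eventually_ge_at_top[of j]
  proof eventually_elim
    case (elim N)
    have "real j < (1 - \<kappa>) * real N"
      using m elim(1) assms by (smt (verit) mult_left_mono of_nat_mono)
    thus ?case using elim(2) by (simp add: cone_kappa_def of_nat_diff algebra_simps)
  qed
qed

lemma cone_omega_contains_top:
  assumes "width_seq \<omega>"
  shows "\<forall>\<^sub>F N in sequentially. (N - j, 2 ^ N) \<in> cone_omega \<omega>"
proof -
  have pow: "filterlim (\<lambda>N. 2 ^ N :: nat) at_top sequentially"
    by (rule filterlim_at_top_mono[OF filterlim_ident]) (simp add: less_imp_le)
  have "filterlim \<omega> at_top sequentially" using assms by (simp add: width_seq_def)
  from filterlim_compose[OF this pow]
  have "\<forall>\<^sub>F N in sequentially. Suc j \<le> \<omega> (2 ^ N)"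
    by (simp add: filterlim_at_top)
  thus ?thesis
    using eventually_ge_at_top[of j]
    by eventually_elim (auto simp: cone_omega_def)
qed

section \<open>Ratios bounded away from 1\<close>

text \<open>Two regimes share one bound. Inside the cone, iterating the ratio bound down from the top
  gives the first summand. Below the cone only monotonicity is left, and the second summand bounds
  what the geometric decay has reached on leaving the cone, at least \<open>(1 - \<kappa>) * top_bit n\<close>
  steps below the top.\<close>

lemma weight_decay_below_top:
  assumes W: "weight_system W" and \<kappa>: "0 < \<kappa>" "\<kappa> < 1" and q: "1 < q" and n: "1 \<le> n"
    and top: "W (top_bit n) n \<le> C"
    and step: "\<And>k. (k, n) \<in> cone_kappa \<kappa> \<Longrightarrow> q * W (k - 1) n \<le> W k n"
    and k: "k \<le> top_bit n"
  shows "W k n \<le> C * ((1 / q) ^ (top_bit n - k) + (q powr (\<kappa> - 1)) ^ top_bit n)"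
proof -
  define N where "N = top_bit n"
  have C: "0 < C" using top weight_pos[OF W, of "top_bit n" n] by simp
  \<comment> \<open>The index reached may lie one step below the cone, since the last ratio used is the one at
    the lowest index of the cone.\<close>
  have decay: "W (N - j) n \<le> C * (1 / q) ^ j" if "j \<le> N" "\<kappa> * real N < real (N - j) + 1" for j
    using that
  proof (induction j)
    case 0
    thus ?case using top by (simp add: N_def)
  next
    case (Suc j)
    have "(N - j, n) \<in> cone_kappa \<kappa>"
      using Suc.prems n by (simp add: cone_kappa_def N_def of_nat_diff)
    hence "q * W (N - Suc j) n \<le> W (N - j) n" using step by fastforce
    also have "\<dots> \<le> C * (1 / q) ^ j" using Suc by (simp add: of_nat_diff)
    finally show ?case using q by (simp add: field_simps)
  qed
  show ?thesis
  proof (cases "\<kappa> * real N < real k")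
    case True
    have "W k n \<le> C * (1 / q) ^ (N - k)"
      using decay[of "N - k"] True k by (simp add: N_def)
    also have "\<dots> \<le> C * ((1 / q) ^ (N - k) + (q powr (\<kappa> - 1)) ^ N)"
      using C q by (intro mult_left_mono) auto
    finally show ?thesis by (simp add: N_def)
  next
    case False
    define K where "K = nat \<lfloor>\<kappa> * real N\<rfloor>"
    have K: "real K \<le> \<kappa> * real N" "\<kappa> * real N < real K + 1"
      using \<kappa> by (auto simp: K_def)
    have "real K \<le> real N" using K(1) \<kappa> mult_right_mono[of \<kappa> 1 "real N"] by simp
    hence KN: "K \<le> N" by simp
    have "k \<le> K" using False K(2) by linarith
    hence "W k n \<le> W K n" by (rule weight_mono[OF W])
    also have "\<dots> \<le> C * (1 / q) ^ (N - K)"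
      using decay[of "N - K"] KN K(2) by simp
    also have "(1 / q) ^ (N - K) = q powr (- real (N - K))"
      using q by (simp add: powr_minus powr_realpow power_divide inverse_eq_divide)
    also have "\<dots> \<le> q powr ((\<kappa> - 1) * real N)"
      using q K(1) KN by (intro powr_mono) (auto simp: of_nat_diff algebra_simps)
    also have "\<dots> = (q powr (\<kappa> - 1)) ^ N"
      using q by (simp add: powr_powr flip: powr_realpow)
    also have "C * \<dots> \<le> C * ((1 / q) ^ (N - k) + (q powr (\<kappa> - 1)) ^ N)"
      using C q by (intro mult_left_mono) auto
    finally show ?thesis using C by (simp add: N_def mult_left_mono)
  qed
qed

text \<open>Summed over a column, the first summand of the decay bound gives a geometric series and the
  second one \<open>(N + 1) * s ^ N\<close> with \<open>s < 1\<close>, which is bounded in \<open>N\<close>. The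
  finitely many lower levels contribute columns of at most \<open>N0\<close> weights, each at most \<open>C\<close>.\<close>

lemma weight_sums_bounded_if_ratios_exceed_one:
  assumes W: "weight_system W" and \<kappa>: "0 < \<kappa>" "\<kappa> < 1" and q: "1 < q"
    and top: "\<And>n. 1 \<le> n \<Longrightarrow> W (top_bit n) n \<le> C"
    and step: "\<And>k n. (k, n) \<in> cone_kappa \<kappa> \<Longrightarrow> N0 \<le> top_bit n \<Longrightarrow> q * W (k - 1) n \<le> W k n"
  obtains M where "\<And>n. 1 \<le> n \<Longrightarrow> (\<Sum>k=0..top_bit n. W k n) \<le> M"
proof -
  define s where "s = q powr (\<kappa> - 1)"
  have s: "0 < s" "s < 1" using q \<kappa> by (auto simp: s_def powr_less_one)
  have C: "0 < C" using top[of 1] weight_pos[OF W, of "top_bit 1" 1] by simp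
  have "(\<lambda>N. real N * s ^ N + s ^ N) \<longlonglongrightarrow> 0 + 0"
    using s by (intro tendsto_add powser_times_n_limit_0 LIMSEQ_power_zero) auto
  hence "Bseq (\<lambda>N. real (Suc N) * s ^ N)"
    by (intro convergent_imp_Bseq) (auto simp: convergent_def algebra_simps)
  then obtain B where B: "\<And>N. real (Suc N) * s ^ N \<le> B"
    unfolding Bseq_def using s by (auto simp: abs_mult)
  define G where "G = 1 / (1 - 1 / q)"
  have G: "(\<Sum>j\<le>N. (1 / q) ^ j) \<le> G" for N
    using q sum_le_suminf[of "\<lambda>j. (1 / q) ^ j" "{..N}"]
    by (simp add: G_def suminf_geometric summable_geometric)
  show thesis
  proof
    fix n :: nat assume n: "1 \<le> n"
    define N where "N = top_bit n"
    have rev: "(\<Sum>k=0..N. (1 / q) ^ (N - k)) = (\<Sum>j\<le>N. (1 / q) ^ j)"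
      by (rule sum.reindex_bij_witness[of _ "\<lambda>j. N - j" "\<lambda>k. N - k"]) auto
    show "(\<Sum>k=0..top_bit n. W k n) \<le> max (C * (G + B)) (real (Suc N0) * C)"
    proof (cases "N0 \<le> N")
      case True
      have "(\<Sum>k=0..N. W k n) \<le> (\<Sum>k=0..N. C * ((1 / q) ^ (N - k) + s ^ N))"
      proof (intro sum_mono)
        fix k assume "k \<in> {0..N}"
        hence k: "k \<le> top_bit n" by (simp add: N_def)
        have "q * W (l - 1) n \<le> W l n" if "(l, n) \<in> cone_kappa \<kappa>" for l
          using step[OF that] True by (simp add: N_def)
        from weight_decay_below_top[OF W \<kappa> q n top[OF n] this k]
        show "W k n \<le> C * ((1 / q) ^ (N - k) + s ^ N)" by (simp add: N_def s_def)
      qed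
      also have "\<dots> = C * ((\<Sum>j\<le>N. (1 / q) ^ j) + real (Suc N) * s ^ N)"
        by (simp add: rev sum.distrib flip: sum_distrib_left)
      also have "\<dots> \<le> C * (G + B)"
        using C G B by (intro mult_left_mono add_mono) auto
      finally show ?thesis by (simp add: N_def)
    next
      case False
      have "(\<Sum>k=0..N. W k n) \<le> (\<Sum>k=0..N. C)"
      proof (intro sum_mono)
        fix k assume "k \<in> {0..N}"
        hence "W k n \<le> W N n" by (intro weight_mono[OF W]) simp
        thus "W k n \<le> C" using top[OF n] by (simp add: N_def)
      qed
      also have "\<dots> \<le> real (Suc N0) * C" using False C by simp
      finally show ?thesis by (simp add: N_def)
    qed
  qed
qed

text \<open>Admissibility provides some limit of the ratios. It is at least 1 since the ratios are and the
  cone contains pairs with \<open>top_bit n\<close> arbitrarily large, and it cannot exceed 1 by the preceding lemma.\<close>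

lemma ratios_tend_to_one_if_weight_sums_unbounded:
  assumes W: "weight_system W" and \<kappa>: "0 < \<kappa>" "\<kappa> < 1"
    and adm: "admissible (cone_kappa \<kappa>) W"
    and unbounded: "(SUP n\<in>{1..}. ereal (\<Sum>k=0..top_bit n. W k n)) = \<infinity>"
  shows "cone_lim (cone_kappa \<kappa>) (\<lambda>k n. W k n / W (k - 1) n) 1"
proof -
  obtain L C where lim: "cone_lim (cone_kappa \<kappa>) (\<lambda>k n. W k n / W (k - 1) n) L"
    and C: "\<And>n. 1 \<le> n \<Longrightarrow> W (top_bit n) n \<le> C"
    using adm unfolding admissible_def by blast
  have near: "\<exists>N0. \<forall>k n. (k, n) \<in> cone_kappa \<kappa> \<longrightarrow> N0 \<le> top_bit n \<longrightarrow> \<bar>W k n / W (k - 1) n - L\<bar> < e"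
    if "0 < e" for e
    using lim that unfolding cone_lim_def by fast
  have "\<not> L < 1"
  proof
    assume "L < 1"
    then obtain N0 where N0: "\<And>k n. (k, n) \<in> cone_kappa \<kappa> \<Longrightarrow> N0 \<le> top_bit n \<Longrightarrow>
        \<bar>W k n / W (k - 1) n - L\<bar> < 1 - L"
      using near[of "1 - L"] by auto
    obtain N where "(N - 0, 2 ^ N) \<in> cone_kappa \<kappa>" "N0 \<le> N"
      using eventually_happens[OF eventually_conj[OF cone_kappa_contains_top[OF \<kappa>(2), of 0]
            eventually_ge_at_top[of N0]]] by auto
    hence "\<bar>W N (2 ^ N) / W (N - 1) (2 ^ N) - L\<bar> < 1 - L" using N0 by simp
    thus False using ratio_ge_1[OF W, of N "2 ^ N"] by linarith
  qed
  moreover have "\<not> 1 < L"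
  proof
    assume L: "1 < L"
    define q where "q = (1 + L) / 2"
    have q: "1 < q" "0 < L - q" using L by (auto simp: q_def)
    obtain N0 where N0: "\<And>k n. (k, n) \<in> cone_kappa \<kappa> \<Longrightarrow> N0 \<le> top_bit n \<Longrightarrow>
        \<bar>W k n / W (k - 1) n - L\<bar> < L - q"
      using near[OF q(2)] by auto
    have step: "q * W (k - 1) n \<le> W k n" if "(k, n) \<in> cone_kappa \<kappa>" "N0 \<le> top_bit n" for k n
    proof -
      have "q \<le> W k n / W (k - 1) n" using N0[OF that] by linarith
      thus ?thesis using weight_pos[OF W, of "k - 1" n] by (simp add: pos_le_divide_eq)
    qed
    obtain M where M: "\<And>n. 1 \<le> n \<Longrightarrow> (\<Sum>k=0..top_bit n. W k n) \<le> M"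
      using weight_sums_bounded_if_ratios_exceed_one[OF W \<kappa> q(1) C step] by blast
    obtain n where "1 \<le> n" "M + 1 \<le> (\<Sum>k=0..top_bit n. W k n)"
      using unbounded unfolding SUP_ereal_eq_infinity_iff by force
    with M[of n] show False by simp
  qed
  ultimately show ?thesis using lim by (cases "L = 1") auto
qed

section \<open>Unbounded sums with ratios tending to 2 in a narrow cone\<close>

definition slow_width :: "nat \<Rightarrow> nat" where
  "slow_width n = Suc (top_bit (top_bit (top_bit n)))"

text \<open>For \<open>k > top_bit n\<close> the truncated subtraction continues the top weight 1.\<close>

definition plateau_weight :: "nat \<Rightarrow> nat \<Rightarrow> real" where
  "plateau_weight k n = (1 / 2) ^ min (top_bit n - k) (slow_width n)"

text \<open>Three iterations of \<open>top_bit\<close> are what makes \<open>2 ^ slow_width n\<close> small against \<open>top_bit n\<close>: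
  with \<open>m = top_bit (top_bit n)\<close> positive it is at most \<open>2 * m\<close>, while \<open>top_bit n\<close> is at least \<open>2 ^ m\<close>. With
  two iterations both would have the same order.\<close>

lemma top_bit_over_pow2_slow_width:
  "filterlim (\<lambda>n. real (top_bit n) / 2 ^ slow_width n) at_top sequentially"
proof (rule filterlim_at_top_mono)
  have "filterlim (\<lambda>m. 2 ^ m / (2 * real m)) at_top sequentially" by real_asymp
  moreover have "filterlim (\<lambda>n. top_bit (top_bit n)) at_top sequentially"
    by (rule filterlim_compose[OF filterlim_top_bit filterlim_top_bit])
  ultimately show "filterlim (\<lambda>n. 2 ^ top_bit (top_bit n) / (2 * real (top_bit (top_bit n))))
      at_top sequentially"
    by (rule filterlim_compose)
  have "\<forall>\<^sub>F n in sequentially. 1 \<le> top_bit (top_bit n)"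
    by (intro eventually_compose_filterlim[OF eventually_ge_at_top]
        filterlim_compose[OF filterlim_top_bit filterlim_top_bit])
  thus "\<forall>\<^sub>F n in sequentially. 2 ^ top_bit (top_bit n) / (2 * real (top_bit (top_bit n)))
      \<le> real (top_bit n) / 2 ^ slow_width n"
  proof eventually_elim
    case (elim n)
    define m where "m = top_bit (top_bit n)"
    have "1 \<le> top_bit n"
      using elim by (cases "top_bit n") auto
    hence "real (2 ^ m) \<le> real (top_bit n)"
      unfolding m_def by (intro of_nat_mono pow2_top_bit_le)
    moreover have "real (2 ^ top_bit m) \<le> real m"
      using elim unfolding m_def by (intro of_nat_mono pow2_top_bit_le)
    hence "(2 :: real) ^ slow_width n \<le> 2 * real m"
      by (simp add: slow_width_def m_def)
    ultimately show ?case
      by (fold m_def, intro frac_le) auto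
  qed
qed

lemma width_seq_slow_width: "width_seq slow_width"
  unfolding width_seq_def
proof (intro conjI)
  show "\<forall>n\<ge>1. 0 < slow_width n" by (simp add: slow_width_def)
  show "mono_on {1..} slow_width"
    by (simp add: mono_on_def slow_width_def top_bit_mono)
  show "filterlim slow_width at_top sequentially"
    unfolding slow_width_def
    by (intro filterlim_compose[OF filterlim_Suc] filterlim_compose[OF filterlim_top_bit] filterlim_top_bit)
  show "filterlim (\<lambda>n. real (top_bit n) / real (slow_width n)) at_top sequentially"
  proof (rule filterlim_at_top_mono[OF top_bit_over_pow2_slow_width], intro always_eventually allI)
    fix n
    have "real (slow_width n) \<le> real (2 ^ slow_width n)"
      by (intro of_nat_mono less_imp_le less_exp)
    thus "real (top_bit n) / 2 ^ slow_width n \<le> real (top_bit n) / real (slow_width n)"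
      by (intro frac_le) (auto simp: slow_width_def)
  qed
qed

lemma slow_width_le: "1 \<le> top_bit n \<Longrightarrow> slow_width n \<le> top_bit n"
  using top_bit_less[of "top_bit n"] top_bit_less[of "top_bit (top_bit n)"]
  by (cases "top_bit (top_bit n) = 0") (auto simp: slow_width_def)

lemma weight_system_plateau: "weight_system plateau_weight"
  unfolding weight_system_def plateau_weight_def
  by (auto intro!: power_decreasing)

text \<open>On each level beyond the lowest the narrow cone stays above index 0, where the truncated
  predecessor would give the ratio 1.\<close>

lemma plateau_ratio:
  assumes "(k, n) \<in> cone_omega slow_width" "1 \<le> top_bit n"
  shows "plateau_weight k n / plateau_weight (k - 1) n = 2"
proof -
  have k: "1 \<le> k" "k \<le> top_bit n" "top_bit n < k + slow_width n"
    using assms slow_width_le[OF assms(2)] by (auto simp: cone_omega_def)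
  hence "min (top_bit n - (k - 1)) (slow_width n) = Suc (top_bit n - k)"
    and "min (top_bit n - k) (slow_width n) = top_bit n - k"
    by auto
  moreover have "(1 / 2 :: real) ^ m / (1 / 2) ^ Suc m = 2" for m by simp
  ultimately show ?thesis by (simp only: plateau_weight_def)
qed

lemma plateau_cone_lim:
  "cone_lim (cone_omega slow_width) (\<lambda>k n. plateau_weight k n / plateau_weight (k - 1) n) 2"
  unfolding cone_lim_def using plateau_ratio by fastforce

lemma plateau_sums_unbounded:
  "(SUP n\<in>{1..}. ereal (\<Sum>k=0..top_bit n. plateau_weight k n)) = \<infinity>"
  unfolding SUP_ereal_eq_infinity_iff
proof
  fix M
  have "\<forall>\<^sub>F n in sequentially. M \<le> real (top_bit n) / 2 ^ slow_width n"
    using top_bit_over_pow2_slow_width by (simp add: filterlim_at_top)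
  then obtain n where n: "1 \<le> n" "M \<le> real (top_bit n) / 2 ^ slow_width n"
    using eventually_happens[OF eventually_conj[OF _ eventually_ge_at_top[of 1]]] by force
  note n(2)
  also have "real (top_bit n) / 2 ^ slow_width n \<le> (\<Sum>k=0..top_bit n. (1 / 2) ^ slow_width n)"
    by (simp add: power_divide field_simps)
  also have "\<dots> \<le> (\<Sum>k=0..top_bit n. plateau_weight k n)"
    unfolding plateau_weight_def by (intro sum_mono power_decreasing) auto
  finally show "\<exists>n\<in>{1..}. M \<le> (\<Sum>k=0..top_bit n. plateau_weight k n)" using n(1) by auto
qed

lemma plateau_admissible: "admissible (cone_omega slow_width) plateau_weight"
proof -
  have "plateau_weight (top_bit n) n = 1" for n by (simp add: plateau_weight_def)
  thus ?thesis
    unfolding admissible_def using plateau_cone_lim by (metis less_numeral_extra(1) order_refl)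
qed

theorem theorem3:
  shows
    "(\<forall>(\<kappa>::real) (W :: nat \<Rightarrow> nat \<Rightarrow> real).
        0 < \<kappa> \<and> \<kappa> < 1 \<and> weight_system W \<and> admissible (cone_kappa \<kappa>) W \<longrightarrow>
        (cone_lim (cone_kappa \<kappa>) (\<lambda>k n. W k n / W (k - 1) n) 1 \<longleftrightarrow>
         (SUP n\<in>{1..}. ereal (\<Sum>k=0..top_bit n. W k n)) = \<infinity>))
     \<and>
     (\<forall>(\<omega> :: nat \<Rightarrow> nat) (W :: nat \<Rightarrow> nat \<Rightarrow> real).
        width_seq \<omega> \<and> weight_system W \<and> admissible (cone_omega \<omega>) W \<and>
        cone_lim (cone_omega \<omega>) (\<lambda>k n. W k n / W (k - 1) n) 1 \<longrightarrow>
        (SUP n\<in>{1..}. ereal (\<Sum>k=0..top_bit n. W k n)) = \<infinity>)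
     \<and>
     (\<exists>(\<omega> :: nat \<Rightarrow> nat) (W :: nat \<Rightarrow> nat \<Rightarrow> real).
        width_seq \<omega> \<and> weight_system W \<and> admissible (cone_omega \<omega>) W \<and>
        (SUP n\<in>{1..}. ereal (\<Sum>k=0..top_bit n. W k n)) = \<infinity> \<and>
        (\<exists>L. cone_lim (cone_omega \<omega>) (\<lambda>k n. W k n / W (k - 1) n) L \<and> L \<noteq> 1))"
proof (intro conjI allI impI, goal_cases)
  case (1 \<kappa> W)
  hence \<kappa>: "0 < \<kappa>" "\<kappa> < 1" and W: "weight_system W" and adm: "admissible (cone_kappa \<kappa>) W"
    by auto
  obtain c where c: "0 < c" "\<And>n. 1 \<le> n \<Longrightarrow> c \<le> W (top_bit n) n"
    using adm unfolding admissible_def by blast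
  show ?case
    using weight_sums_unbounded_if_ratios_tend_to_one[OF W c _ cone_kappa_contains_top[OF \<kappa>(2)]]
      ratios_tend_to_one_if_weight_sums_unbounded[OF W \<kappa> adm]
    by blast
next
  case (2 \<omega> W)
  hence \<omega>: "width_seq \<omega>" and W: "weight_system W" and adm: "admissible (cone_omega \<omega>) W"
    and lim: "cone_lim (cone_omega \<omega>) (\<lambda>k n. W k n / W (k - 1) n) 1"
    by auto
  obtain c where c: "0 < c" "\<And>n. 1 \<le> n \<Longrightarrow> c \<le> W (top_bit n) n"
    using adm unfolding admissible_def by blast
  show ?case
    by (rule weight_sums_unbounded_if_ratios_tend_to_one[OF W c lim cone_omega_contains_top[OF \<omega>]])
next
  case 3
  have "(2 :: real) \<noteq> 1" by simp
  with width_seq_slow_width weight_system_plateau plateau_admissible plateau_sums_unbounded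
    plateau_cone_lim
  show ?case by blast
qed

end
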